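(* Let $f(x,y) = -xy\,e^{-x^2-y^2} + \tfrac12 y^2$ and $\mathcal{F} = \{(x,y)\in\mathbb{R}^2 : x+y\le 0\}$. For any constant step-size $\bar\alpha$ with $0<\bar\alpha<\tfrac23$, there exists $\epsilon>0$ such that if the initial point $(x_0,y_0)$ lies in the set $$\{(x,y) : 0.5-\epsilon\le x\le 0.5,\ -0.5-\epsilon\le y\le -0.5\},$$ then the sequence generated by the projected gradient descent method with fixed step-size $\bar\alpha$, applied to the problem of minimizing $f$ over $\mathcal{F}$, converges to the origin $(0,0)$.
   Context: Projected gradient descent with constant step-size $\bar\alpha$ for minimizing $f$ over a closed convex set $\mathcal{F}$ generates iterates $z_{k+1} = \mathcal{P}_{\mathcal{F}}(z_k - \bar\alpha\nabla f(z_k))$, $k=0,1,2,\dots$, where $z_k=(x_k,y_k)$ and $\mathcal{P}_{\mathcal{F}}$ is the Euclidean projection onto $\mathcal{F}$. *)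

theory Defs
  imports "HOL-Analysis.Analysis"
begin

text \<open>The plane is \<^typ>\<open>real \<times> real\<close>, whose library norm and inner product are the Euclidean ones.\<close>

text \<open>Meaningful at points where \<open>f\<close> is (Frechet) differentiable; unspecified elsewhere.\<close>

definition gradient :: "('a::real_inner \<Rightarrow> real) \<Rightarrow> 'a \<Rightarrow> 'a" where
  "gradient f z = (THE D. GDERIV f z :> D)"

lemma gradient_eq:
  assumes "GDERIV f z :> D"
  shows "gradient f z = D"
  unfolding gradient_def
proof (rule the_equality)
  show "GDERIV f z :> D" by (fact assms)
  fix D' assume "GDERIV f z :> D'"
  with assms have "(\<lambda>h. inner h D') = (\<lambda>h. inner h D)"
    unfolding gderiv_def by (rule has_derivative_unique[rotated])
  then have "inner h D' = inner h D" for h by meson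
  then show "D' = D" by (metis inner_commute vector_eq_rdot)
qed

primrec projected_gradient_descent ::
  "('a::{real_inner,heine_borel} \<Rightarrow> real) \<Rightarrow> 'a set \<Rightarrow> real \<Rightarrow> 'a \<Rightarrow> nat \<Rightarrow> 'a" where
  "projected_gradient_descent f F \<alpha> z0 0 = z0"
| "projected_gradient_descent f F \<alpha> z0 (Suc k) =
     closest_point F
       (projected_gradient_descent f F \<alpha> z0 k
        - \<alpha> *\<^sub>R gradient f (projected_gradient_descent f F \<alpha> z0 k))"

definition objective :: "real \<times> real \<Rightarrow> real" where
  "objective = (\<lambda>(x, y). - x * y * exp (- x\<^sup>2 - y\<^sup>2) + 1/2 * y\<^sup>2)"

definition feasible_set :: "(real \<times> real) set" where
  "feasible_set = {(x, y). x + y \<le> 0}"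

end

theory Submission
  imports Defs
begin

text \<open>
  The boundary line of the feasible half-plane traps the iteration. At a boundary point
  \<open>(t, - t)\<close> with \<open>t \<ge> 0\<close> the two components of the gradient add up to \<open>- t\<close>, so the
  unconstrained step leaves the half-plane (or stays on its boundary) and the projection brings
  it back to the line. On the line the method is thus the scalar recursion
  \<open>t \<mapsto> t * (1 - \<alpha> * (1/2 + (1 - 2 * t\<^sup>2) * exp (- 2 * t\<^sup>2)))\<close>
  (lemma \<open>projected_step_on_boundary\<close>). For \<open>0 \<le> t \<le> 1/2\<close> the term multiplied by \<open>\<alpha>\<close> lies
  between \<open>1/2\<close> and \<open>3/2\<close>; the upper bound and \<open>\<alpha> < 2/3\<close> prevent \<open>t\<close> from changing sign,
  and the lower bound makes \<open>t\<close> shrink by the factor \<open>1 - \<alpha>/2\<close> at least. Hence the iterates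
  tend to the origin geometrically.

  The starting point need not lie on the line, but \<open>(1/2, - 1/2)\<close> does, and its unconstrained
  step ends strictly outside the half-plane. By continuity the first step from every
  sufficiently close starting point also ends outside, so the first iterate is already on the
  line, with a parameter still strictly between \<open>0\<close> and \<open>1/2\<close>.
\<close>

definition grad_x :: "real \<Rightarrow> real \<Rightarrow> real" where
  "grad_x x y = - y * (1 - 2 * x\<^sup>2) * exp (- x\<^sup>2 - y\<^sup>2)"

definition grad_y :: "real \<Rightarrow> real \<Rightarrow> real" where
  "grad_y x y = - x * (1 - 2 * y\<^sup>2) * exp (- x\<^sup>2 - y\<^sup>2) + y"

lemma gradient_objective: "gradient objective (x, y) = (grad_x x y, grad_y x y)"
proof (rule gradient_eq)
  have eq: "objective = (\<lambda>z. - fst z * snd z * exp (- (fst z)\<^sup>2 - (snd z)\<^sup>2) + 1/2 * (snd z)\<^sup>2)"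
    by (auto simp: objective_def fun_eq_iff)
  show "GDERIV objective (x, y) :> (grad_x x y, grad_y x y)"
    unfolding gderiv_def eq
    by (rule derivative_eq_intros refl)+
      (auto simp: grad_x_def grad_y_def fun_eq_iff inner_prod_def algebra_simps power2_eq_square)
qed

lemma feasible_set_halfspace: "feasible_set = {z. inner (1, 1) z \<le> 0}"
  by (auto simp: feasible_set_def inner_prod_def)

text \<open>Outside the half-plane, the squared distance to a feasible \<open>(p, q)\<close> is at least
  \<open>((a - p) + (b - q))\<^sup>2 / 2 \<ge> (a + b)\<^sup>2 / 2\<close>, and the orthogonal projection onto the
  boundary line attains this bound.\<close>

lemma closest_point_feasible_set:
  assumes "a + b \<ge> 0"
  shows "closest_point feasible_set (a, b) = ((a - b) / 2, - ((a - b) / 2))"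
proof (rule closest_point_unique[symmetric])
  show "convex feasible_set" "closed feasible_set"
    unfolding feasible_set_halfspace by (rule convex_halfspace_le closed_halfspace_le)+
  show "((a - b) / 2, - ((a - b) / 2)) \<in> feasible_set"
    by (simp add: feasible_set_def)
  show "\<forall>z\<in>feasible_set. dist (a, b) ((a - b) / 2, - ((a - b) / 2)) \<le> dist (a, b) z"
  proof
    fix z :: "real \<times> real"
    assume "z \<in> feasible_set"
    then obtain p q where z: "z = (p, q)" and "p + q \<le> 0"
      by (auto simp: feasible_set_def)
    then have "(a + b)\<^sup>2 \<le> ((a - p) + (b - q))\<^sup>2"
      using assms by (intro power_mono) auto
    also have "\<dots> \<le> 2 * ((a - p)\<^sup>2 + (b - q)\<^sup>2)"
      using zero_le_power2[of "(a - p) - (b - q)"] by (simp add: power2_eq_square algebra_simps)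
    finally have "(a + b)\<^sup>2 \<le> 2 * ((a - p)\<^sup>2 + (b - q)\<^sup>2)" .
    moreover have "(a - (a - b) / 2)\<^sup>2 + (b + (a - b) / 2)\<^sup>2 = (a + b)\<^sup>2 / 2"
      by (simp add: power2_eq_square field_simps)
    ultimately show "dist (a, b) ((a - b) / 2, - ((a - b) / 2)) \<le> dist (a, b) z"
      by (simp add: z dist_Pair_Pair dist_real_def)
  qed
qed

text \<open>Used away from the boundary for the first step only, and on the boundary for all later
  ones.\<close>

lemma projected_step_onto_boundary:
  assumes "x + y - \<alpha> * (grad_x x y + grad_y x y) \<ge> 0"
    and "t = (x - y - \<alpha> * (grad_x x y - grad_y x y)) / 2"
  shows "closest_point feasible_set ((x, y) - \<alpha> *\<^sub>R gradient objective (x, y)) = (t, - t)"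
proof -
  have "closest_point feasible_set (x - \<alpha> * grad_x x y, y - \<alpha> * grad_y x y) = (t, - t)"
    using assms by (subst closest_point_feasible_set) (simp_all add: algebra_simps)
  then show ?thesis
    by (simp add: gradient_objective)
qed

lemma projected_step_on_boundary:
  assumes "0 \<le> \<alpha>" and "0 \<le> t"
  shows "closest_point feasible_set ((t, - t) - \<alpha> *\<^sub>R gradient objective (t, - t)) =
    (t * (1 - \<alpha> * (1/2 + (1 - 2 * t\<^sup>2) * exp (- 2 * t\<^sup>2))),
     - (t * (1 - \<alpha> * (1/2 + (1 - 2 * t\<^sup>2) * exp (- 2 * t\<^sup>2)))))"
proof (rule projected_step_onto_boundary)
  have "grad_x t (- t) + grad_y t (- t) = - t"
    by (simp add: grad_x_def grad_y_def)
  then show "0 \<le> t + - t - \<alpha> * (grad_x t (- t) + grad_y t (- t))"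
    using assms by simp
  show "t * (1 - \<alpha> * (1/2 + (1 - 2 * t\<^sup>2) * exp (- 2 * t\<^sup>2))) =
    (t - - t - \<alpha> * (grad_x t (- t) - grad_y t (- t))) / 2"
    by (simp add: grad_x_def grad_y_def field_simps)
qed

lemma boundary_recursion_bounds:
  fixes t \<alpha> :: real
  assumes "0 \<le> \<alpha>" "\<alpha> \<le> 2/3" and "0 \<le> t" "t \<le> 1/2"
  defines "t' \<equiv> t * (1 - \<alpha> * (1/2 + (1 - 2 * t\<^sup>2) * exp (- 2 * t\<^sup>2)))"
  shows "0 \<le> t'" and "t' \<le> t * (1 - \<alpha> / 2)"
proof -
  define g where "g = (1 - 2 * t\<^sup>2) * exp (- 2 * t\<^sup>2)"
  have "t\<^sup>2 \<le> (1/2)\<^sup>2"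
    using assms by (intro power_mono)
  then have "0 \<le> 1 - 2 * t\<^sup>2"
    by (simp add: power2_eq_square)
  then have "0 \<le> g" "g \<le> 1"
    by (auto simp: g_def intro: mult_le_one)
  have "\<alpha> * (1/2 + g) \<le> 2/3 * (3/2)"
    using assms \<open>0 \<le> g\<close> \<open>g \<le> 1\<close> by (intro mult_mono) auto
  then show "0 \<le> t'"
    using assms unfolding t'_def g_def[symmetric] by (intro mult_nonneg_nonneg) auto
  have "0 \<le> \<alpha> * g"
    using assms \<open>0 \<le> g\<close> by simp
  then show "t' \<le> t * (1 - \<alpha> / 2)"
    using assms unfolding t'_def g_def[symmetric]
    by (intro mult_left_mono) (auto simp: algebra_simps)
qed

text \<open>The decay rate also serves as the invariant: it keeps \<open>s \<le> 1/2\<close>, the range in which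
  \<open>boundary_recursion_bounds\<close> gives the next factor \<open>1 - \<alpha>/2\<close>.\<close>

lemma boundary_iterates_decay:
  assumes "0 \<le> \<alpha>" "\<alpha> \<le> 2/3"
    and "projected_gradient_descent objective feasible_set \<alpha> z (Suc 0) = (t, - t)"
    and "0 \<le> t" "t \<le> 1/2"
  shows "\<exists>s. projected_gradient_descent objective feasible_set \<alpha> z (Suc k) = (s, - s)
    \<and> 0 \<le> s \<and> s \<le> 1/2 * (1 - \<alpha> / 2) ^ k"
proof (induction k)
  case 0
  then show ?case using assms by auto
next
  case (Suc k)
  then obtain s where s: "projected_gradient_descent objective feasible_set \<alpha> z (Suc k) = (s, - s)"
    "0 \<le> s" "s \<le> 1/2 * (1 - \<alpha> / 2) ^ k"
    by blast
  have "(1 - \<alpha> / 2) ^ k \<le> 1"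
    using assms by (intro power_le_one) auto
  with s have "s \<le> 1/2" by simp
  define s' where "s' = s * (1 - \<alpha> * (1/2 + (1 - 2 * s\<^sup>2) * exp (- 2 * s\<^sup>2)))"
  have "projected_gradient_descent objective feasible_set \<alpha> z (Suc (Suc k)) = (s', - s')"
    unfolding projected_gradient_descent.simps(2)[of _ _ _ _ "Suc k"] s(1) s'_def
    by (rule projected_step_on_boundary) fact+
  moreover have "0 \<le> s'" "s' \<le> s * (1 - \<alpha> / 2)"
    using boundary_recursion_bounds[of \<alpha> s] assms s \<open>s \<le> 1/2\<close> by (auto simp: s'_def)
  moreover have "s * (1 - \<alpha> / 2) \<le> 1/2 * (1 - \<alpha> / 2) ^ k * (1 - \<alpha> / 2)"
    using s assms by (intro mult_right_mono) auto
  then have "s * (1 - \<alpha> / 2) \<le> 1/2 * (1 - \<alpha> / 2) ^ Suc k"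
    by (simp only: power_Suc2 mult.assoc)
  ultimately show ?case
    by (blast intro: order_trans)
qed

lemma converges_to_origin_from_boundary:
  assumes "0 < \<alpha>" "\<alpha> \<le> 2/3"
    and "projected_gradient_descent objective feasible_set \<alpha> z (Suc 0) = (t, - t)"
    and "0 \<le> t" "t \<le> 1/2"
  shows "projected_gradient_descent objective feasible_set \<alpha> z \<longlonglongrightarrow> (0, 0)"
proof -
  have "\<exists>s. projected_gradient_descent objective feasible_set \<alpha> z (Suc k) = (s, - s)
    \<and> 0 \<le> s \<and> s \<le> 1/2 * (1 - \<alpha> / 2) ^ k" for k
    using assms by (intro boundary_iterates_decay) auto
  then obtain s where
    s: "\<And>k. projected_gradient_descent objective feasible_set \<alpha> z (Suc k) = (s k, - s k)"
      "\<And>k. 0 \<le> s k" "\<And>k. s k \<le> 1/2 * (1 - \<alpha> / 2) ^ k"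
    by metis
  have "(\<lambda>k. (1 - \<alpha> / 2) ^ k) \<longlonglongrightarrow> 0"
    using assms by (intro LIMSEQ_realpow_zero) auto
  then have bound: "(\<lambda>k. 1/2 * (1 - \<alpha> / 2) ^ k) \<longlonglongrightarrow> 0"
    by (rule tendsto_mult_right_zero)
  have "s \<longlonglongrightarrow> 0"
    by (rule tendsto_sandwich[OF always_eventually always_eventually tendsto_const bound])
      (rule allI s(2,3))+
  then have "(\<lambda>k. (s k, - s k)) \<longlonglongrightarrow> (0, - 0)"
    by (intro tendsto_intros)
  then show ?thesis
    by (subst filterlim_sequentially_Suc[symmetric]) (simp add: s(1) del: projected_gradient_descent.simps)
qed

text \<open>All three inequalities are strict at \<open>(1/2, - 1/2)\<close>, so continuity carries them to a
  neighbourhood.\<close>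

lemma first_step_onto_boundary_near_corner:
  assumes "0 < \<alpha>" "\<alpha> < 2/3"
  shows "\<exists>d>0. \<forall>x y. dist (x, y) (1/2, - 1/2) < d \<longrightarrow>
    0 < x + y - \<alpha> * (grad_x x y + grad_y x y) \<and>
    0 < x - y - \<alpha> * (grad_x x y - grad_y x y) \<and>
    x - y - \<alpha> * (grad_x x y - grad_y x y) < 1"
proof -
  define p :: "real \<times> real" where "p = (1/2, - 1/2)"
  define S where "S z = fst z + snd z - \<alpha> * (grad_x (fst z) (snd z) + grad_y (fst z) (snd z))" for z
  define T where "T z = fst z - snd z - \<alpha> * (grad_x (fst z) (snd z) - grad_y (fst z) (snd z))" for z
  have cont: "isCont S p" "isCont T p"
    unfolding S_def T_def grad_x_def grad_y_def by (intro continuous_intros)+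
  define E :: real where "E = exp (- 1/2)"
  have E: "0 < E" "E < 1" by (simp_all add: E_def)
  have "S p = \<alpha> / 2" and Tp: "T p = 1 - \<alpha> * (1/2 + E / 2)"
    by (simp_all add: S_def T_def p_def grad_x_def grad_y_def E_def power2_eq_square field_simps)
  then have "0 < S p" using assms by simp
  have "\<alpha> * (1/2 + E / 2) \<le> 2/3 * 1"
    using assms E by (intro mult_mono) auto
  moreover have "0 < \<alpha> * (1/2 + E / 2)"
    using assms E by (intro mult_pos_pos) auto
  ultimately have "0 < T p" "T p < 1"
    unfolding Tp by linarith+
  have "(S \<longlongrightarrow> S p) (nhds p)" "(T \<longlongrightarrow> T p) (nhds p)"
    using cont unfolding continuous_at tendsto_at_iff_tendsto_nhds by blast+
  then have "eventually (\<lambda>z. 0 < S z \<and> 0 < T z \<and> T z < 1) (nhds p)"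
    using \<open>0 < S p\<close> \<open>0 < T p\<close> \<open>T p < 1\<close>
    by (intro eventually_conj order_tendstoD)
  then obtain d where "d > 0" "\<And>z. dist z p < d \<Longrightarrow> 0 < S z \<and> 0 < T z \<and> T z < 1"
    unfolding eventually_nhds_metric by blast
  from this(2)[of "(_, _)"] show ?thesis
    using \<open>d > 0\<close> unfolding S_def T_def p_def fst_conv snd_conv by blast
qed

theorem theorem3p2:
  fixes \<alpha> :: real
  assumes "0 < \<alpha>" and "\<alpha> < 2/3"
  shows "\<exists>\<epsilon>>0. \<forall>(x0::real) (y0::real).
           (x0, y0) \<in> {(x, y). 1/2 - \<epsilon> \<le> x \<and> x \<le> 1/2 \<and> - 1/2 - \<epsilon> \<le> y \<and> y \<le> - 1/2} \<longrightarrow>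
           projected_gradient_descent objective feasible_set \<alpha> (x0, y0) \<longlonglongrightarrow> (0, 0)"
proof -
  obtain d where "d > 0" and d: "\<And>x y. dist (x, y) (1/2, - 1/2) < d \<Longrightarrow>
    0 < x + y - \<alpha> * (grad_x x y + grad_y x y) \<and>
    0 < x - y - \<alpha> * (grad_x x y - grad_y x y) \<and>
    x - y - \<alpha> * (grad_x x y - grad_y x y) < 1"
    using first_step_onto_boundary_near_corner[OF assms] by blast
  show ?thesis
    \<comment> \<open>The ball of radius \<open>d\<close> has to contain the box of side \<open>\<epsilon>\<close>; any \<open>\<epsilon> < d / 2\<close> ensures this.\<close>
  proof (intro exI[of _ "d / 3"] conjI allI impI)
    show "d / 3 > 0" using \<open>d > 0\<close> by simp
    fix x y :: real
    assume xy: "(x, y) \<in> {(x, y). 1/2 - d / 3 \<le> x \<and> x \<le> 1/2 \<and> - 1/2 - d / 3 \<le> y \<and> y \<le> - 1/2}"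
    have "dist (x, y) (1/2, - 1/2) \<le> \<bar>x - 1/2\<bar> + \<bar>y - - 1/2\<bar>"
      by (simp add: dist_Pair_Pair dist_real_def sqrt_sum_squares_le_sum_abs[THEN order_trans])
    also have "\<dots> < d"
      using xy \<open>d > 0\<close> by auto
    finally have *: "0 < x + y - \<alpha> * (grad_x x y + grad_y x y)"
      "0 < x - y - \<alpha> * (grad_x x y - grad_y x y)"
      "x - y - \<alpha> * (grad_x x y - grad_y x y) < 1"
      using d by blast+
    show "projected_gradient_descent objective feasible_set \<alpha> (x, y) \<longlonglongrightarrow> (0, 0)"
    proof (rule converges_to_origin_from_boundary)
      show "projected_gradient_descent objective feasible_set \<alpha> (x, y) (Suc 0) =
        ((x - y - \<alpha> * (grad_x x y - grad_y x y)) / 2, - ((x - y - \<alpha> * (grad_x x y - grad_y x y)) / 2))"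
        unfolding projected_gradient_descent.simps
        by (rule projected_step_onto_boundary) (use * in auto)
    qed (use * assms in auto)
  qed
qed

end
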